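(* Let $\gamma>0$. Then we have the convolution-type formula $$\frac{n!\,\mathscr{M}_n(x;\beta,c,\gamma)}{(\gamma+1)_n}=\sum_{k=0}^{n}\binom{n}{k}\frac{\gamma}{k+\gamma}\,M_{n-k}(x;\beta,c)\,M_k(-x-1;2-\beta,c).$$ Moreover, we have the generating function $$\sum_{n=0}^{+\infty}\frac{\gamma\,(c\,t)^n}{(n+\gamma)\,n!}M_n(x;\beta,c)=F_1\left[\gamma,x+\beta,-x;\gamma+1;\,c\,t,\,t\right],\qquad |t|<|c|^{-1},\quad(\gamma\text{ arbitrary}).$$
   Context: The associated Meixner polynomials $\mathscr{M}_n(x;\beta,c,\gamma)$, with association parameter $\gamma$, are defined by $\mathscr{M}_{-1}=0$, $\mathscr{M}_0=1$ and, for $n\ge 0$, $$c\,\mathscr{M}_{n+1}(x;\beta,c,\gamma)=[(c-1)x+(c+1)(n+\gamma)+\beta c]\,\mathscr{M}_n(x;\beta,c,\gamma)-(n+\gamma)(n+\gamma+\beta-1)\,\mathscr{M}_{n-1}(x;\beta,c,\gamma).$$ The conditions for their orthogonality are $c>0$, $c\ne1$ and $\gamma+\beta>0$. The Meixner polynomials are the case $\gamma=0$: $M_n(x;\beta,c)=\mathscr{M}_n(x;\beta,c,0)=(\beta)_n\,{}_2F_1(-n,-x;\beta;1-\frac1c)$. Pochhammer symbol: $(a)_0=1$, $(a)_k=a(a+1)\cdots(a+k-1)$ for $k\ge1$. The first Appell hypergeometric function is $$F_1[\alpha,\beta_1,\beta_2;\sigma;X,Y]=\sum_{m,n\ge0}\frac{(\alpha)_{m+n}(\beta_1)_m(\beta_2)_n}{(\sigma)_{m+n}}\frac{X^m}{m!}\frac{Y^n}{n!},\qquad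 \max\{|X|,|Y|\}<1.$$
   Formalization: The generating function is proved for |t|<1 as well as |t|<1/|c|, the domain of F1 (for |c|<1 the stated range fails: x=-1, β=1, c=1/2, γ=1 diverges for 1<|t|<2), and "γ arbitrary" means γ not in {0,-1,-2,...}, where the denominators vanish. *)

theory Defs
  imports "HOL-Analysis.Analysis"
begin

fun assoc_meixner :: "nat \<Rightarrow> 'a \<Rightarrow> 'a \<Rightarrow> 'a \<Rightarrow> 'a \<Rightarrow> 'a::field_char_0" where
  "assoc_meixner 0 x \<beta> c \<gamma> = 1"
| "assoc_meixner (Suc 0) x \<beta> c \<gamma> = ((c - 1) * x + (c + 1) * \<gamma> + \<beta> * c) / c"
| "assoc_meixner (Suc (Suc n)) x \<beta> c \<gamma> =
     (((c - 1) * x + (c + 1) * (of_nat (Suc n) + \<gamma>) + \<beta> * c) * assoc_meixner (Suc n) x \<beta> c \<gamma>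
      - (of_nat (Suc n) + \<gamma>) * (of_nat (Suc n) + \<gamma> + \<beta> - 1) * assoc_meixner n x \<beta> c \<gamma>) / c"

text \<open>The three-term recurrence in its usual form; the conditional is the
  convention that the polynomial of index \<open>-1\<close> is zero.\<close>

lemma assoc_meixner_recurrence:
  assumes "c \<noteq> 0"
  shows "c * assoc_meixner (Suc n) x \<beta> c \<gamma> =
    ((c - 1) * x + (c + 1) * (of_nat n + \<gamma>) + \<beta> * c) * assoc_meixner n x \<beta> c \<gamma>
    - (of_nat n + \<gamma>) * (of_nat n + \<gamma> + \<beta> - 1)
      * (if n = 0 then 0 else assoc_meixner (n - 1) x \<beta> c \<gamma>)"
  using assms by (cases n) simp_all

definition meixner :: "nat \<Rightarrow> 'a \<Rightarrow> 'a \<Rightarrow> 'a \<Rightarrow> 'a::field_char_0" where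
  "meixner n x \<beta> c = assoc_meixner n x \<beta> c 0"

text \<open>The first Appell function as an unconditional double sum. It is meaningful for
  \<open>max (norm X) (norm Y) < 1\<close> and \<open>\<sigma>\<close> not a nonpositive integer; outside the region of
  summability the value of the infinite sum is a junk value.\<close>

definition appell_F1 :: "complex \<Rightarrow> complex \<Rightarrow> complex \<Rightarrow> complex \<Rightarrow> complex \<Rightarrow> complex \<Rightarrow> complex" where
  "appell_F1 \<alpha> b1 b2 \<sigma> X Y =
     (\<Sum>\<^sub>\<infinity>(m, n)\<in>UNIV.
        pochhammer \<alpha> (m + n) * pochhammer b1 m * pochhammer b2 n / pochhammer \<sigma> (m + n)
        * (X ^ m / fact m) * (Y ^ n / fact n))"

end

(* The generating function G of M_n(x; beta, c) / n! satisfies (1 - s)(c - s) G' = P G with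
   P = (c - 1) x + beta c - beta s, so G = (1 - s)^(-x-beta) (1 - s/c)^x. Replacing (x, beta) by
   (-x-1, 2-beta) gives a companion G* with G G* = c / ((1 - s)(c - s)). The recurrence of the
   associated polynomials says that H = sum_n assoc_n s^n / (gamma + 1)_n is the unique power
   series with (1 - s)(c - s)(s H' + gamma H) = s P H + gamma c. Variation of constants
   solves it: H = G K, where s K' + gamma K = gamma G*; this is the convolution formula.
   For the Appell function, (gamma)_N / (gamma + 1)_N = gamma / (N + gamma) depends only on
   N = m + n, and summing the absolutely convergent double series along the diagonals
   m + n = N leaves the coefficients of G(c t) = (1 - c t)^(-x-beta) (1 - t)^x. *)

theory Submission
  imports Defs "HOL-Computational_Algebra.Formal_Power_Series"
begin

unbundle no vec_syntax
unbundle fps_syntax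

definition meixner_fps :: "'a \<Rightarrow> 'a \<Rightarrow> 'a \<Rightarrow> 'a::field_char_0 fps" where
  "meixner_fps x \<beta> c = Abs_fps (\<lambda>n. meixner n x \<beta> c / fact n)"

definition meixner_quad :: "'a \<Rightarrow> 'a::field_char_0 fps" where
  "meixner_quad c = (1 - fps_X) * (fps_const c - fps_X)"

definition meixner_lin :: "'a \<Rightarrow> 'a \<Rightarrow> 'a \<Rightarrow> 'a::field_char_0 fps" where
  "meixner_lin x \<beta> c = fps_const ((c - 1) * x + \<beta> * c) - fps_const \<beta> * fps_X"

lemma meixner_quad_mult:
  "meixner_quad c * F = fps_const c * F - fps_const (c + 1) * (fps_X * F) + fps_X * (fps_X * F)"
  by (simp add: meixner_quad_def algebra_simps flip: fps_const_add)

lemma meixner_lin_mult: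
  "meixner_lin x \<beta> c * F = fps_const ((c - 1) * x + \<beta> * c) * F - fps_const \<beta> * (fps_X * F)"
  by (simp add: meixner_lin_def algebra_simps)

lemma pochhammer_succ_nonzero:
  fixes \<gamma> :: "'a::field_char_0"
  assumes "\<And>n. of_nat (Suc n) + \<gamma> \<noteq> 0"
  shows "pochhammer (\<gamma> + 1) n \<noteq> 0"
proof
  assume "pochhammer (\<gamma> + 1) n = 0"
  then obtain k where "\<gamma> + 1 = - of_nat k"
    by (auto simp: pochhammer_eq_0_iff)
  then have "\<gamma> + 1 + of_nat k = 0"
    by simp
  then have "of_nat (Suc k) + \<gamma> = 0"
    by (simp add: add_ac)
  with assms show False by blast
qed

lemma assoc_meixner_fps_unique:
  fixes x \<beta> c \<gamma> :: "'a::field_char_0"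
  assumes c: "c \<noteq> 0" and \<gamma>: "\<And>n. of_nat (Suc n) + \<gamma> \<noteq> 0" and H0: "H $ 0 = 1"
    and ode: "meixner_quad c * (fps_X * fps_deriv H + fps_const \<gamma> * H)
              = fps_X * (meixner_lin x \<beta> c * H) + fps_const (\<gamma> * c)"
  shows "H $ n = assoc_meixner n x \<beta> c \<gamma> / pochhammer (\<gamma> + 1) n"
proof -
  have rec: "c * (of_nat (Suc n) + \<gamma>) * H $ Suc n =
      ((c - 1) * x + (c + 1) * (of_nat n + \<gamma>) + \<beta> * c) * H $ n
      - (if n = 0 then 0 else (of_nat n + \<gamma> + \<beta> - 1) * H $ (n - 1))" for n
    using arg_cong[OF ode[unfolded meixner_quad_mult meixner_lin_mult], of "\<lambda>F. F $ Suc n"]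
    by (cases n; cases "n - 1") (auto simp: algebra_simps)
  have "H $ n * pochhammer (\<gamma> + 1) n = assoc_meixner n x \<beta> c \<gamma>"
  proof (induction n rule: less_induct)
    case (less n)
    consider "n = 0" | "n = 1" | m where "n = Suc (Suc m)"
      by (metis One_nat_def old.nat.exhaust)
    then show ?case
    proof cases
      case 1
      then show ?thesis by (simp add: H0)
    next
      case 2
      with rec[of 0] c show ?thesis
        by (simp add: H0 field_simps)
    next
      case (3 m)
      have IH: "assoc_meixner (Suc m) x \<beta> c \<gamma> = H $ Suc m * (pochhammer (\<gamma> + 1) m * (of_nat (Suc m) + \<gamma>))"
          "assoc_meixner m x \<beta> c \<gamma> = H $ m * pochhammer (\<gamma> + 1) m"
        using less.IH[of m] less.IH[of "Suc m"] 3 by (simp_all add: pochhammer_Suc add_ac)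
      have "c * (H $ n * pochhammer (\<gamma> + 1) n) =
          (c * (of_nat (Suc (Suc m)) + \<gamma>) * H $ Suc (Suc m))
            * (pochhammer (\<gamma> + 1) m * (of_nat (Suc m) + \<gamma>))"
        using 3 by (simp add: pochhammer_Suc add_ac mult_ac)
      also have "\<dots> = c * assoc_meixner n x \<beta> c \<gamma>"
        unfolding rec 3 assoc_meixner_recurrence[OF c] diff_Suc_1 IH
        by (simp add: algebra_simps)
      finally show ?thesis using c by simp
    qed
  qed
  then show ?thesis
    using pochhammer_succ_nonzero[OF \<gamma>] by (simp add: eq_divide_eq)
qed

lemma meixner_fps_unique:
  fixes x \<beta> c :: "'a::field_char_0"
  assumes "c \<noteq> 0" "F $ 0 = 1" "meixner_quad c * fps_deriv F = meixner_lin x \<beta> c * F"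
  shows "F = meixner_fps x \<beta> c"
proof (rule fps_ext)
  fix n
  have "F $ n = assoc_meixner n x \<beta> c 0 / pochhammer (0 + 1) n"
  proof (rule assoc_meixner_fps_unique)
    show "meixner_quad c * (fps_X * fps_deriv F + fps_const 0 * F)
        = fps_X * (meixner_lin x \<beta> c * F) + fps_const (0 * c)"
      by (simp add: assms(3)[symmetric] mult.left_commute)
    show "of_nat (Suc n) + 0 \<noteq> (0::'a)" for n
      by (simp del: of_nat_Suc)
  qed (use assms in auto)
  then show "F $ n = meixner_fps x \<beta> c $ n"
    by (simp add: meixner_fps_def meixner_def pochhammer_fact)
qed

definition pochhammer_fps :: "'a \<Rightarrow> 'a \<Rightarrow> 'a::field_char_0 fps" where
  "pochhammer_fps a d = Abs_fps (\<lambda>n. pochhammer a n / fact n / d ^ n)"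

lemma pochhammer_fps_deriv:
  fixes a d :: "'a::field_char_0"
  assumes "d \<noteq> 0"
  shows "(fps_const d - fps_X) * fps_deriv (pochhammer_fps a d) = fps_const a * pochhammer_fps a d"
proof (rule fps_ext)
  fix n
  have *: "(1 + of_nat n) * (pochhammer a (Suc n) / fact (Suc n)) = (a + of_nat n) * (pochhammer a n / fact n)" for n
    using of_nat_neq_0[of n, where 'a='a]
    by (simp add: pochhammer_Suc field_simps del: of_nat_Suc) (simp add: algebra_simps)
  have rec: "d * fps_deriv (pochhammer_fps a d) $ n = (a + of_nat n) * pochhammer_fps a d $ n" for n
  proof -
    have "d * fps_deriv (pochhammer_fps a d) $ n
        = (1 + of_nat n) * (pochhammer a (Suc n) / fact (Suc n)) / d ^ n"
      using assms by (simp add: pochhammer_fps_def del: fact_Suc)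
    then show ?thesis
      by (simp only: *) (simp add: pochhammer_fps_def)
  qed
  show "((fps_const d - fps_X) * fps_deriv (pochhammer_fps a d)) $ n
      = (fps_const a * pochhammer_fps a d) $ n"
    by (cases n) (use rec[of n] in \<open>auto simp: algebra_simps\<close>)
qed

lemma pochhammer_fps_mult_deriv:
  fixes x \<beta> c :: "'a::field_char_0"
  assumes "c \<noteq> 0"
  shows "meixner_quad c * fps_deriv (pochhammer_fps (x + \<beta>) 1 * pochhammer_fps (- x) c)
    = meixner_lin x \<beta> c * (pochhammer_fps (x + \<beta>) 1 * pochhammer_fps (- x) c)"
proof -
  let ?f = "pochhammer_fps (x + \<beta>) 1" and ?g = "pochhammer_fps (- x) c"
  have f: "(1 - fps_X) * fps_deriv ?f = fps_const (x + \<beta>) * ?f"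
    using pochhammer_fps_deriv[of 1 "x + \<beta>"] by simp
  have g: "(fps_const c - fps_X) * fps_deriv ?g = fps_const (- x) * ?g"
    using pochhammer_fps_deriv[OF assms] .
  have "meixner_quad c * fps_deriv (?f * ?g) =
      (fps_const c - fps_X) * ?g * ((1 - fps_X) * fps_deriv ?f)
      + (1 - fps_X) * ?f * ((fps_const c - fps_X) * fps_deriv ?g)"
    by (simp add: meixner_quad_def algebra_simps)
  also have "\<dots> = ((fps_const c - fps_X) * fps_const (x + \<beta>) - (1 - fps_X) * fps_const x) * (?f * ?g)"
    unfolding f g by (simp add: algebra_simps flip: fps_const_neg)
  also have "(fps_const c - fps_X) * fps_const (x + \<beta>) - (1 - fps_X) * fps_const x = meixner_lin x \<beta> c"
    by (simp add: meixner_lin_def algebra_simps fps_eq_iff)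
  finally show ?thesis .
qed

lemma meixner_fps_eq:
  fixes x \<beta> c :: "'a::field_char_0"
  assumes "c \<noteq> 0"
  shows "meixner_fps x \<beta> c = pochhammer_fps (x + \<beta>) 1 * pochhammer_fps (- x) c"
  by (rule meixner_fps_unique[OF assms, symmetric])
    (simp add: pochhammer_fps_def, rule pochhammer_fps_mult_deriv[OF assms])

lemma meixner_fps_nth_0: "meixner_fps x \<beta> c $ 0 = 1"
  by (simp add: meixner_fps_def meixner_def)

lemma meixner_fps_deriv:
  fixes x \<beta> c :: "'a::field_char_0"
  assumes "c \<noteq> 0"
  shows "meixner_quad c * fps_deriv (meixner_fps x \<beta> c) = meixner_lin x \<beta> c * meixner_fps x \<beta> c"
  unfolding meixner_fps_eq[OF assms] by (rule pochhammer_fps_mult_deriv[OF assms])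

lemma meixner_fps_mult_dual:
  fixes x \<beta> c :: "'a::field_char_0"
  assumes "c \<noteq> 0"
  shows "meixner_quad c * (meixner_fps x \<beta> c * meixner_fps (- x - 1) (2 - \<beta>) c) = fps_const c"
proof -
  let ?Q = "meixner_quad c"
  let ?G = "meixner_fps x \<beta> c" and ?G' = "meixner_fps (- x - 1) (2 - \<beta>) c"
  have Q0: "?Q $ 0 = c"
    by (simp add: meixner_quad_def)
  have Q: "?Q \<noteq> 0"
    using assms Q0 by auto
  have log: "fps_deriv ?Q + meixner_lin x \<beta> c + meixner_lin (- x - 1) (2 - \<beta>) c = 0"
    by (simp add: meixner_quad_def meixner_lin_def fps_eq_iff fps_numeral_nth algebra_simps)
  have "?Q * fps_deriv (?Q * (?G * ?G')) =
      ?Q * (fps_deriv ?Q * (?G * ?G') + (?Q * fps_deriv ?G) * ?G' + ?G * (?Q * fps_deriv ?G'))"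
    by (simp add: algebra_simps)
  also have "\<dots> = ?Q * ((fps_deriv ?Q + meixner_lin x \<beta> c + meixner_lin (- x - 1) (2 - \<beta>) c) * (?G * ?G'))"
    unfolding meixner_fps_deriv[OF assms] by (simp add: algebra_simps)
  finally have "fps_deriv (?Q * (?G * ?G')) = 0"
    using Q by (simp add: log del: fps_deriv_mult)
  then show ?thesis
    by (simp add: fps_deriv_eq_0_iff Q0 meixner_fps_nth_0 del: fps_deriv_mult)
qed

lemma assoc_meixner_convolution:
  fixes x \<beta> c \<gamma> :: "'a::field_char_0"
  assumes c: "c \<noteq> 0" and \<gamma>: "\<And>n. of_nat n + \<gamma> \<noteq> 0"
  shows "fact n * assoc_meixner n x \<beta> c \<gamma> / pochhammer (\<gamma> + 1) n =
    (\<Sum>k=0..n. of_nat (n choose k) * (\<gamma> / (of_nat k + \<gamma>))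
        * meixner (n - k) x \<beta> c * meixner k (- x - 1) (2 - \<beta>) c)"
proof -
  let ?Q = "meixner_quad c"
  let ?G = "meixner_fps x \<beta> c" and ?G' = "meixner_fps (- x - 1) (2 - \<beta>) c"
  define K where "K = Abs_fps (\<lambda>k. \<gamma> / (of_nat k + \<gamma>) * ?G' $ k)"
  have K: "fps_X * fps_deriv K + fps_const \<gamma> * K = fps_const \<gamma> * ?G'"
  proof (rule fps_ext)
    fix k
    have "(fps_X * fps_deriv K + fps_const \<gamma> * K) $ k = (of_nat k + \<gamma>) * K $ k"
      by (cases k) (auto simp: algebra_simps)
    then show "(fps_X * fps_deriv K + fps_const \<gamma> * K) $ k = (fps_const \<gamma> * ?G') $ k"
      using \<gamma>[of k] by (simp add: K_def)
  qed
  have "(?G * K) $ n = assoc_meixner n x \<beta> c \<gamma> / pochhammer (\<gamma> + 1) n"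
  proof (rule assoc_meixner_fps_unique[OF c])
    show "(?G * K) $ 0 = 1"
      using \<gamma>[of 0] by (simp add: K_def meixner_fps_nth_0)
    have "?Q * (fps_X * fps_deriv (?G * K) + fps_const \<gamma> * (?G * K)) =
        fps_X * ((?Q * fps_deriv ?G) * K)
        + ?Q * (?G * (fps_X * fps_deriv K + fps_const \<gamma> * K))"
      by (simp add: algebra_simps)
    also have "\<dots> = fps_X * (meixner_lin x \<beta> c * (?G * K)) + fps_const \<gamma> * (?Q * (?G * ?G'))"
      unfolding K meixner_fps_deriv[OF c] by (simp add: algebra_simps)
    finally show "?Q * (fps_X * fps_deriv (?G * K) + fps_const \<gamma> * (?G * K)) =
        fps_X * (meixner_lin x \<beta> c * (?G * K)) + fps_const (\<gamma> * c)"
      by (simp add: meixner_fps_mult_dual[OF c])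
  qed (rule \<gamma>)
  moreover have "(?G * K) $ n = (K * ?G) $ n"
    by (simp add: mult.commute)
  ultimately have "fact n * assoc_meixner n x \<beta> c \<gamma> / pochhammer (\<gamma> + 1) n
      = (\<Sum>k=0..n. fact n * (K $ k * ?G $ (n - k)))"
    unfolding sum_distrib_left[symmetric] fps_mult_nth[symmetric]
    by (metis times_divide_eq_right)
  also have "\<dots> = (\<Sum>k=0..n. of_nat (n choose k) * (\<gamma> / (of_nat k + \<gamma>))
        * meixner (n - k) x \<beta> c * meixner k (- x - 1) (2 - \<beta>) c)"
    by (rule sum.cong) (auto simp: K_def meixner_fps_def binomial_fact mult_ac)
  finally show ?thesis .
qed

lemma summable_norm_pochhammer_series:
  fixes a z :: complex
  assumes "norm z < 1"
  shows "summable (\<lambda>n. norm (pochhammer a n / fact n * z ^ n))"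
proof -
  have "(\<lambda>n. norm (pochhammer a n / fact n * z ^ n)) = (\<lambda>n. norm (((- a) gchoose n) * z ^ n))"
    by (auto simp: gbinomial_pochhammer norm_mult norm_divide norm_power)
  moreover have "ereal (norm z) < conv_radius (\<lambda>n. (- a) gchoose n)"
    using assms by (simp add: conv_radius_gchoose one_ereal_def)
  ultimately show ?thesis
    using abs_summable_in_conv_radius by metis
qed

lemma pochhammer_quotient_succ:
  fixes \<gamma> :: "'a::field_char_0"
  assumes "\<And>n. of_nat n + \<gamma> \<noteq> 0"
  shows "pochhammer \<gamma> n / pochhammer (\<gamma> + 1) n = \<gamma> / (of_nat n + \<gamma>)"
proof -
  have "pochhammer \<gamma> n * (of_nat n + \<gamma>) = \<gamma> * pochhammer (\<gamma> + 1) n"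
    by (metis add.commute mult.commute pochhammer_Suc pochhammer_rec)
  then show ?thesis
    using assms pochhammer_succ_nonzero[OF assms] by (simp add: field_simps)
qed

lemma meixner_generating_appell:
  fixes x \<beta> c \<gamma> t :: complex
  assumes c: "c \<noteq> 0" and \<gamma>: "\<And>n. of_nat n + \<gamma> \<noteq> 0" and ct: "norm (c * t) < 1" and t: "norm t < 1"
  shows "(\<lambda>n. \<gamma> * (c * t) ^ n / ((of_nat n + \<gamma>) * fact n) * meixner n x \<beta> c)
    sums appell_F1 \<gamma> (x + \<beta>) (- x) (\<gamma> + 1) (c * t) t"
proof -
  define f where "f m = pochhammer (x + \<beta>) m / fact m * (c * t) ^ m" for m
  define g where "g k = pochhammer (- x) k / fact k * t ^ k" for k
  define w where "w n = \<gamma> / (of_nat n + \<gamma>)" for n :: nat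
  define T where "T = (\<lambda>(m, k). w (m + k) * (f m * g k))"
  have F1: "appell_F1 \<gamma> (x + \<beta>) (- x) (\<gamma> + 1) (c * t) t = infsum T UNIV"
    unfolding appell_F1_def
  proof (rule infsum_cong, clarify)
    fix m k
    show "pochhammer \<gamma> (m + k) * pochhammer (x + \<beta>) m * pochhammer (- x) k / pochhammer (\<gamma> + 1) (m + k)
        * ((c * t) ^ m / fact m) * (t ^ k / fact k) = T (m, k)"
      unfolding T_def w_def f_def g_def prod.case pochhammer_quotient_succ[OF \<gamma>, symmetric]
      by (simp add: mult_ac)
  qed
  have "w \<longlonglongrightarrow> 0"
    unfolding w_def
    by (rule tendsto_divide_0[OF tendsto_const
          tendsto_add_filterlim_at_infinity'[OF tendsto_of_nat tendsto_const]])
  then have "Bseq w"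
    by (intro convergent_imp_Bseq convergentI)
  then obtain B where B: "\<And>n. norm (w n) \<le> B"
    by (auto simp: Bseq_def)
  have f: "(\<lambda>m. norm (f m)) summable_on UNIV" and g: "(\<lambda>k. norm (g k)) summable_on UNIV"
    using summable_norm_pochhammer_series[OF ct] summable_norm_pochhammer_series[OF t]
    by (auto simp: f_def g_def intro!: norm_summable_imp_summable_on)
  have "(\<lambda>(m, k). norm (f m) * norm (g k)) summable_on (UNIV \<times> UNIV)"
  proof (rule summable_on_SigmaI)
    show "((\<lambda>k. case (m, k) of (m, k) \<Rightarrow> norm (f m) * norm (g k))
        has_sum norm (f m) * infsum (\<lambda>k. norm (g k)) UNIV) UNIV" for m
      using has_sum_cmult_right[OF has_sum_infsum[OF g], of "norm (f m)"] by simp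
    show "(\<lambda>m. norm (f m) * infsum (\<lambda>k. norm (g k)) UNIV) summable_on UNIV"
      using f by (rule summable_on_cmult_left)
  qed simp
  then have "(\<lambda>p. B * (case p of (m, k) \<Rightarrow> norm (f m) * norm (g k))) summable_on UNIV"
    by (intro summable_on_cmult_right) simp
  then have "(\<lambda>p. norm (T p)) summable_on UNIV"
    by (rule Infinite_Sum.abs_summable_on_comparison_test')
      (auto simp: T_def norm_mult intro!: mult_right_mono B)
  then have "(T has_sum infsum T UNIV) UNIV"
    by (rule has_sum_infsum[OF abs_summable_summable])
  also have "?this \<longleftrightarrow> ((\<lambda>(n, m). T (m, n - m)) has_sum infsum T UNIV) (SIGMA n:UNIV. {0..n})"
    by (intro has_sum_reindex_bij_witness[of _ "\<lambda>(n, m). (m, n - m)" "\<lambda>(m, k). (m + k, m)"]) auto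
  finally have "((\<lambda>(n, m). T (m, n - m)) has_sum infsum T UNIV) (SIGMA n:UNIV. {0..n})" .
  then have "((\<lambda>n. \<Sum>m=0..n. T (m, n - m)) has_sum infsum T UNIV) UNIV"
  proof (rule has_sum_SigmaD)
    show "((\<lambda>m. case (n, m) of (n, m) \<Rightarrow> T (m, n - m)) has_sum (\<Sum>m=0..n. T (m, n - m))) {0..n}" for n
      unfolding prod.case by (rule has_sum_finite) simp
  qed
  then have "(\<lambda>n. \<Sum>m=0..n. T (m, n - m)) sums infsum T UNIV"
    by (rule has_sum_imp_sums)
  moreover have "(\<Sum>m=0..n. T (m, n - m)) = \<gamma> * (c * t) ^ n / ((of_nat n + \<gamma>) * fact n) * meixner n x \<beta> c" for n
  proof -
    have "meixner n x \<beta> c / fact n = meixner_fps x \<beta> c $ n"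
      by (simp add: meixner_fps_def)
    also have "\<dots> = (\<Sum>m=0..n. pochhammer (x + \<beta>) m / fact m * (pochhammer (- x) (n - m) / fact (n - m) / c ^ (n - m)))"
      by (simp add: meixner_fps_eq[OF c] pochhammer_fps_def fps_mult_nth)
    finally have "w n * (c * t) ^ n * (meixner n x \<beta> c / fact n) =
        (\<Sum>m=0..n. w n * ((c * t) ^ n * (pochhammer (x + \<beta>) m / fact m * (pochhammer (- x) (n - m) / fact (n - m) / c ^ (n - m)))))"
      by (simp add: sum_distrib_left mult.assoc)
    also have "\<dots> = (\<Sum>m=0..n. T (m, n - m))"
    proof (rule sum.cong[OF refl])
      fix m assume "m \<in> {0..n}"
      then have "(c * t) ^ n = (c * t) ^ m * (c ^ (n - m) * t ^ (n - m))"
        by (simp flip: power_add power_mult_distrib)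
      with \<open>m \<in> {0..n}\<close> c show "w n * ((c * t) ^ n * (pochhammer (x + \<beta>) m / fact m
          * (pochhammer (- x) (n - m) / fact (n - m) / c ^ (n - m)))) = T (m, n - m)"
        by (simp add: T_def f_def g_def)
    qed
    finally show ?thesis
      by (simp add: w_def mult_ac)
  qed
  ultimately show ?thesis
    by (simp add: F1)
qed

theorem proposition2p2:
  fixes x \<beta> c :: complex
  assumes "c \<noteq> 0"
  shows
    "(\<forall>(\<gamma>::real) (n::nat). \<gamma> > 0 \<longrightarrow>
        fact n * assoc_meixner n x \<beta> c (of_real \<gamma>) / pochhammer (of_real \<gamma> + 1) n =
        (\<Sum>k=0..n. of_nat (n choose k) * (of_real \<gamma> / (of_nat k + of_real \<gamma>))
                   * meixner (n - k) x \<beta> c * meixner k (- x - 1) (2 - \<beta>) c))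
     \<and>
     (\<forall>(\<gamma>::complex) (t::complex).
        \<gamma> \<notin> \<int>\<^sub>\<le>\<^sub>0 \<longrightarrow> norm t < inverse (norm c) \<longrightarrow> norm t < 1 \<longrightarrow>
        (\<lambda>n. \<gamma> * (c * t) ^ n / ((of_nat n + \<gamma>) * fact n) * meixner n x \<beta> c)
          sums appell_F1 \<gamma> (x + \<beta>) (- x) (\<gamma> + 1) (c * t) t)"
proof (intro conjI allI impI)
  fix \<gamma> :: real and n :: nat
  assume "\<gamma> > 0"
  have "of_nat k + of_real \<gamma> \<noteq> (0::complex)" for k
  proof -
    have "real k + \<gamma> \<noteq> 0"
      using \<open>\<gamma> > 0\<close> by linarith
    then show ?thesis
      by (metis of_real_add of_real_eq_0_iff of_real_of_nat_eq)
  qed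
  then show "fact n * assoc_meixner n x \<beta> c (of_real \<gamma>) / pochhammer (of_real \<gamma> + 1) n =
      (\<Sum>k=0..n. of_nat (n choose k) * (of_real \<gamma> / (of_nat k + of_real \<gamma>))
                 * meixner (n - k) x \<beta> c * meixner k (- x - 1) (2 - \<beta>) c)"
    by (rule assoc_meixner_convolution[OF assms])
next
  fix \<gamma> t :: complex
  assume \<gamma>: "\<gamma> \<notin> \<int>\<^sub>\<le>\<^sub>0" and t: "norm t < inverse (norm c)" "norm t < 1"
  have "of_nat k + \<gamma> \<noteq> 0" for k
  proof
    assume "of_nat k + \<gamma> = 0"
    then have "\<gamma> = - of_nat k"
      by (simp add: add_eq_0_iff)
    with \<gamma> show False by simp
  qed
  moreover have "norm (c * t) < 1"
    using t(1) assms by (simp add: norm_mult field_simps)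
  ultimately show "(\<lambda>n. \<gamma> * (c * t) ^ n / ((of_nat n + \<gamma>) * fact n) * meixner n x \<beta> c)
      sums appell_F1 \<gamma> (x + \<beta>) (- x) (\<gamma> + 1) (c * t) t"
    using meixner_generating_appell[OF assms] t(2) by blast
qed

end
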